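(* Let $G=(V,E)$ be a finite, connected, simple graph and let $\Gamma\subset\mathrm{Aut}(G)$ be a subgroup acting transitively on $V$. Let $U\subset\Delta_\Gamma$ be an open set and let $\lambda:U\to[-1,1]$ be a smooth function such that, for all $X\in U$, $\lambda(X)$ is an eigenvalue of $P_X$ of fixed multiplicity $k\ge2$. Then $X_0\in U$ is a critical point of the function $\lambda$ if and only if the spectral representation $\Phi=\Phi_{P_{X_0},\lambda(X_0)}$, a map from $V$ to a sphere $S^{k-1}\subset\mathbb{R}^k$ centred at the origin, is equilateral.
   Context: Let $V=\{1,\dots,n\}$. Two edges are ($\Gamma$-)equivalent if some $\gamma\in\Gamma$ maps one to the other. Let $[e_1],\dots,[e_N]$ be the equivalence classes of edges and let $m_j$ be the number of edges of $[e_j]$ meeting at a given vertex. Define the simplex $$\Delta_\Gamma=\{(x_1,\dots,x_N)\in[0,1]^N\mid\textstyle\sum_jm_jx_j=1\},$$ and for $X=(x_1,\dots,x_N)\in\Delta_\Gamma$ let $P_X=(p_{ij})\in\mathbb{R}^{n\times n}$ be the symmetric stochastic matrix with $p_{ij}=x_k$ if $\{i,j\}\in[e_k]$ and $p_{ij}=0$ if $i=j$ or $\{i,j\}\notin E$. $P_X$ acts on the space $l^2(G)$ of real functions on $V$ with inner product $\langle f,g\rangle=\sum_{i}f(i)g(i)$. Openness, smoothness and critical points refer to $\Delta_\Gamma$ as a subset of its affine hull $\{\sum_jm_jx_j=1\}$; a critical point is one where the derivative of $\lambda$ vanishes in all directions $\xi\in\mathbb{R}^N$ with $\sum_jm_j\xi_j=0$.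 If $\lambda$ is an eigenvalue of $P$ of multiplicity $k$ and $\phi_1,\dots,\phi_k$ is an orthonormal basis of its eigenspace, the spectral representation is $\Phi_{P,\lambda}:V\to\mathbb{R}^k$, $\Phi_{P,\lambda}(i)=(\phi_1(i),\dots,\phi_k(i))$; it is well defined up to an orthogonal transformation of $\mathbb{R}^k$. It is equilateral if $\|\Phi(i_1)-\Phi(j_1)\|=\|\Phi(i_2)-\Phi(j_2)\|$ (Euclidean norm) for all edges $\{i_1,j_1\},\{i_2,j_2\}\in E$. *)

theory Defs
  imports "HOL-Analysis.Analysis" "HOL-Algebra.Bij"
begin

section \<open>Graphs, automorphisms and edge classes\<close>

text \<open>
  The vertex set is the universe of a finite type \<open>'v\<close>. A graph is given by its set of edges,
  each edge being a two-element set of vertices.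
\<close>

definition simple_graph :: "'v set set \<Rightarrow> bool" where
  "simple_graph E \<longleftrightarrow> (\<forall>e\<in>E. card e = 2)"

definition connected_graph :: "'v set set \<Rightarrow> bool" where
  "connected_graph E \<longleftrightarrow> (\<forall>u v. (u, v) \<in> {(i, j). {i, j} \<in> E}\<^sup>*)"

definition graph_aut :: "'v set set \<Rightarrow> ('v \<Rightarrow> 'v) set" where
  "graph_aut E = {g. bij g \<and> (\<forall>i j. {g i, g j} \<in> E \<longleftrightarrow> {i, j} \<in> E)}"

definition Aut_graph :: "'v set set \<Rightarrow> ('v \<Rightarrow> 'v) monoid" where
  "Aut_graph E = BijGroup UNIV \<lparr>carrier := graph_aut E\<rparr>"

definition vertex_transitive :: "('v \<Rightarrow> 'v) set \<Rightarrow> bool" where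
  "vertex_transitive \<Gamma> \<longleftrightarrow> (\<forall>u v. \<exists>g\<in>\<Gamma>. g u = v)"

definition edge_equiv :: "'v set set \<Rightarrow> ('v \<Rightarrow> 'v) set \<Rightarrow> ('v set \<times> 'v set) set" where
  "edge_equiv E \<Gamma> = {(e, f). e \<in> E \<and> f \<in> E \<and> (\<exists>g\<in>\<Gamma>. g ` e = f)}"

text \<open>
  The classes are indexed by a finite type \<open>'c\<close>: \<open>cls j\<close> is the class \<open>[e\<^sub>j]\<close>, and
  \<open>N = CARD('c)\<close>. (The only case lost is \<open>N = 0\<close>, for which the simplex is empty.)
\<close>

definition enumerates_edge_classes ::
    "'v set set \<Rightarrow> ('v \<Rightarrow> 'v) set \<Rightarrow> ('c::finite \<Rightarrow> 'v set set) \<Rightarrow> bool" where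
  "enumerates_edge_classes E \<Gamma> cls \<longleftrightarrow> bij_betw cls UNIV (E // edge_equiv E \<Gamma>)"

definition class_degree :: "'v \<Rightarrow> 'v set set \<Rightarrow> nat" where
  "class_degree v C = card {e \<in> C. v \<in> e}"

text \<open>
  The vertex at which \<open>m\<^sub>j = class_degree v (cls j)\<close> is counted is an explicit parameter below.
  By transitivity its choice is immaterial:
\<close>

lemma class_degree_vertex_independent:
  fixes E :: "'v::finite set set"
  assumes simple: "simple_graph E"
    and sub: "subgroup \<Gamma> (Aut_graph E)" and tr: "vertex_transitive \<Gamma>"
    and C: "C \<in> E // edge_equiv E \<Gamma>"
  shows "class_degree u C = class_degree v C"
proof -
  have aut: "\<Gamma> \<subseteq> graph_aut E"
    using subgroup.subset[OF sub] by (simp add: Aut_graph_def)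
  have comp: "g \<circ> h \<in> \<Gamma>" if "g \<in> \<Gamma>" "h \<in> \<Gamma>" for g h
  proof -
    have "bij g" "bij h" using that aut by (auto simp: graph_aut_def)
    moreover have "compose UNIV g h = g \<circ> h" by (auto simp: compose_def)
    ultimately show ?thesis
      using subgroup.m_closed[OF sub that]
      by (simp add: Aut_graph_def BijGroup_def Bij_def)
  qed
  obtain e0 where e0: "C = edge_equiv E \<Gamma> `` {e0}"
    using C by (auto elim: quotientE)
  have closed: "g ` e \<in> C" if gG: "g \<in> \<Gamma>" and eC: "e \<in> C" for g e
  proof -
    obtain h where h: "h \<in> \<Gamma>" "h ` e0 = e" "e0 \<in> E" "e \<in> E"
      using eC e0 by (auto simp: edge_equiv_def)
    obtain i j where "e = {i, j}"
      using simple h(4) by (auto simp: simple_graph_def card_2_iff)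
    then have "g ` e \<in> E"
      using h(4) gG aut by (auto simp: graph_aut_def)
    moreover have "(g \<circ> h) ` e0 = g ` e" using h(2) by auto
    ultimately have "(e0, g ` e) \<in> edge_equiv E \<Gamma>"
      using comp[OF gG h(1)] h(3) unfolding edge_equiv_def by blast
    then show ?thesis by (simp add: e0)
  qed
  have le: "class_degree a C \<le> class_degree b C" for a b
  proof -
    obtain g where g: "g \<in> \<Gamma>" "g a = b"
      using tr by (auto simp: vertex_transitive_def)
    then have "inj g" using aut by (auto simp: graph_aut_def bij_def)
    then have "inj_on ((`) g) {e \<in> C. a \<in> e}"
      by (simp add: inj_on_def inj_image_eq_iff)
    moreover have "(`) g ` {e \<in> C. a \<in> e} \<subseteq> {e \<in> C. b \<in> e}"
      using closed g by auto
    ultimately show ?thesis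
      unfolding class_degree_def by (intro card_inj_on_le) auto
  qed
  show ?thesis using le[of u v] le[of v u] by simp
qed

section \<open>The simplex and the transition matrices\<close>

definition weight_hyperplane :: "'v \<Rightarrow> ('c::finite \<Rightarrow> 'v set set) \<Rightarrow> (real ^ 'c) set" where
  "weight_hyperplane v cls = {x. (\<Sum>j\<in>UNIV. real (class_degree v (cls j)) * x $ j) = 1}"

definition weight_directions :: "'v \<Rightarrow> ('c::finite \<Rightarrow> 'v set set) \<Rightarrow> (real ^ 'c) set" where
  "weight_directions v cls = {\<xi>. (\<Sum>j\<in>UNIV. real (class_degree v (cls j)) * \<xi> $ j) = 0}"

definition weight_simplex :: "'v \<Rightarrow> ('c::finite \<Rightarrow> 'v set set) \<Rightarrow> (real ^ 'c) set" where
  "weight_simplex v cls = {x \<in> weight_hyperplane v cls. \<forall>j. x $ j \<in> {0..1}}"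

definition transition_matrix ::
    "'v::finite set set \<Rightarrow> ('c::finite \<Rightarrow> 'v set set) \<Rightarrow> real ^ 'c \<Rightarrow> real ^ 'v ^ 'v" where
  "transition_matrix E cls x =
     (\<chi> i j. if i = j \<or> {i, j} \<notin> E then 0 else x $ (THE k. {i, j} \<in> cls k))"

section \<open>Eigenspaces and spectral representations\<close>

definition eigenspace :: "real ^ 'v ^ 'v \<Rightarrow> real \<Rightarrow> (real ^ 'v::finite) set" where
  "eigenspace P l = {f. P *v f = l *\<^sub>R f}"

definition eigenvalue_of_multiplicity :: "real ^ 'v ^ 'v \<Rightarrow> real \<Rightarrow> nat \<Rightarrow> bool" where
  "eigenvalue_of_multiplicity P l k \<longleftrightarrow>
     (\<exists>f. f \<noteq> 0 \<and> P *v f = l *\<^sub>R f) \<and> dim (eigenspace P l) = k"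

definition orthonormal_basis_of :: "('k \<Rightarrow> real ^ 'v::finite) \<Rightarrow> (real ^ 'v) set \<Rightarrow> bool" where
  "orthonormal_basis_of \<phi> S \<longleftrightarrow>
     (\<forall>a b. \<phi> a \<bullet> \<phi> b = (if a = b then 1 else 0)) \<and> span (range \<phi>) = S"

text \<open>
  The representation depends on the choice of the orthonormal basis, hence a predicate.
\<close>

definition spectral_representation ::
    "real ^ 'v ^ 'v \<Rightarrow> real \<Rightarrow> ('v::finite \<Rightarrow> real ^ 'k::finite) \<Rightarrow> bool" where
  "spectral_representation P l \<Phi> \<longleftrightarrow>
     (\<exists>\<phi>. orthonormal_basis_of \<phi> (eigenspace P l) \<and> \<Phi> = (\<lambda>i. \<chi> a. \<phi> a $ i))"

definition equilateral :: "'v set set \<Rightarrow> ('v \<Rightarrow> real ^ 'k::finite) \<Rightarrow> bool" where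
  "equilateral E \<Phi> \<longleftrightarrow>
     (\<forall>i\<^sub>1 j\<^sub>1 i\<^sub>2 j\<^sub>2. {i\<^sub>1, j\<^sub>1} \<in> E \<longrightarrow> {i\<^sub>2, j\<^sub>2} \<in> E \<longrightarrow>
        norm (\<Phi> i\<^sub>1 - \<Phi> j\<^sub>1) = norm (\<Phi> i\<^sub>2 - \<Phi> j\<^sub>2))"

section \<open>Smooth functions and critical points\<close>

primrec n_times_cont_diff ::
    "nat \<Rightarrow> ('a::euclidean_space \<Rightarrow> real) \<Rightarrow> 'a set \<Rightarrow> bool" where
  "n_times_cont_diff 0 f W \<longleftrightarrow> continuous_on W f"
| "n_times_cont_diff (Suc n) f W \<longleftrightarrow>
     (\<forall>x\<in>W. f differentiable (at x)) \<and>
     (\<forall>v. n_times_cont_diff n (\<lambda>x. frechet_derivative f (at x) v) W)"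

text \<open>
  Smoothness on a set that need not be open in the ambient space, such as an open subset of an
  affine subspace: locally the function extends to a smooth function of the ambient space.
\<close>

definition smooth_function_on :: "('a::euclidean_space \<Rightarrow> real) \<Rightarrow> 'a set \<Rightarrow> bool" where
  "smooth_function_on f U \<longleftrightarrow>
     (\<forall>x\<in>U. \<exists>W F. open W \<and> x \<in> W \<and> (\<forall>n. n_times_cont_diff n F W) \<and>
        (\<forall>y\<in>W \<inter> U. F y = f y))"

text \<open>
  For \<open>U\<close> open in the weight hyperplane, the derivative \<open>D\<close> within \<open>U\<close> is determined on
  \<open>weight_directions\<close>, and only there.
\<close>

definition critical_point ::
    "'v \<Rightarrow> ('c::finite \<Rightarrow> 'v set set) \<Rightarrow> (real ^ 'c) set \<Rightarrow> (real ^ 'c \<Rightarrow> real) \<Rightarrow> real ^ 'c \<Rightarrow> bool"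
  where
  "critical_point v cls U f x \<longleftrightarrow>
     (\<exists>D. (f has_derivative D) (at x within U) \<and> (\<forall>\<xi>\<in>weight_directions v cls. D \<xi> = 0))"

end

theory Submission
  imports Defs
begin

text \<open>
  Let \<open>K i j = \<Phi> i \<bullet> \<Phi> j\<close> be the kernel of the orthogonal projection onto the eigenspace. It is
  \<open>\<Gamma>\<close>-invariant, so \<open>\<Phi>\<close> maps to a sphere and \<open>K\<close> takes a constant value \<open>c\<^sub>j\<close> on each edge class;
  hence \<open>\<Phi>\<close> is equilateral iff all \<open>c\<^sub>j\<close> agree. Along a line \<open>X\<^sub>0 + t \<xi>\<close> the eigenvalue keeps its
  multiplicity, so the compression of \<open>P\<^bsub>\<xi>\<^esub>\<close> to the eigenspace is the scalar \<open>D \<xi>\<close>, where \<open>D\<close> is the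
  derivative of the eigenvalue. Taking traces, \<open>k D \<xi> = n (\<Sum>\<^sub>j m\<^sub>j c\<^sub>j \<xi>\<^sub>j)\<close>, and this functional
  vanishes on \<open>{\<xi>. \<Sum>\<^sub>j m\<^sub>j \<xi>\<^sub>j = 0}\<close> iff the \<open>c\<^sub>j\<close> agree, as all \<open>m\<^sub>j\<close> are positive.
\<close>

section \<open>Edge classes\<close>

lemma mult_Aut_graph:
  assumes "g \<in> graph_aut E" "h \<in> graph_aut E"
  shows "g \<otimes>\<^bsub>Aut_graph E\<^esub> h = g \<circ> h"
  using assms
  by (auto simp: Aut_graph_def BijGroup_def Bij_def graph_aut_def compose_def fun_eq_iff)

lemma one_Aut_graph: "\<one>\<^bsub>Aut_graph E\<^esub> = id"
  by (auto simp: Aut_graph_def BijGroup_def fun_eq_iff)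

lemma inv_into_graph_aut:
  assumes "g \<in> graph_aut E"
  shows "inv_into UNIV g \<in> graph_aut E"
proof -
  have bij: "bij g" using assms by (simp add: graph_aut_def)
  have "{inv_into UNIV g i, inv_into UNIV g j} \<in> E \<longleftrightarrow> {i, j} \<in> E" for i j
  proof -
    have "{g (inv_into UNIV g i), g (inv_into UNIV g j)} \<in> E
        \<longleftrightarrow> {inv_into UNIV g i, inv_into UNIV g j} \<in> E"
      using assms by (simp add: graph_aut_def)
    then show ?thesis
      using bij by (simp add: bij_is_surj surj_f_inv_f)
  qed
  then show ?thesis using bij by (simp add: graph_aut_def bij_imp_bij_inv)
qed

text \<open>\<open>m_inv\<close> is a definite description over the carrier, which is
  \<open>graph_aut E\<close> here rather than all bijections. The inverse function lies in this
  smaller carrier, and uniqueness of two-sided inverses under composition identifies it.\<close>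

lemma m_inv_Aut_graph:
  assumes "g \<in> graph_aut E"
  shows "m_inv (Aut_graph E) g = inv_into UNIV g"
  unfolding m_inv_def
proof (rule the_equality)
  have bij: "bij g" using assms by (simp add: graph_aut_def)
  show "inv_into UNIV g \<in> carrier (Aut_graph E)
      \<and> g \<otimes>\<^bsub>Aut_graph E\<^esub> inv_into UNIV g = \<one>\<^bsub>Aut_graph E\<^esub>
      \<and> inv_into UNIV g \<otimes>\<^bsub>Aut_graph E\<^esub> g = \<one>\<^bsub>Aut_graph E\<^esub>"
    using inv_into_graph_aut[OF assms] assms bij
    by (simp add: mult_Aut_graph one_Aut_graph surj_iff[symmetric] inj_iff[symmetric]
        bij_is_surj bij_is_inj) (simp add: Aut_graph_def)
  fix y
  assume "y \<in> carrier (Aut_graph E)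
      \<and> g \<otimes>\<^bsub>Aut_graph E\<^esub> y = \<one>\<^bsub>Aut_graph E\<^esub> \<and> y \<otimes>\<^bsub>Aut_graph E\<^esub> g = \<one>\<^bsub>Aut_graph E\<^esub>"
  then have "y \<in> graph_aut E" and y: "g \<otimes>\<^bsub>Aut_graph E\<^esub> y = id" "y \<otimes>\<^bsub>Aut_graph E\<^esub> g = id"
    by (auto simp: Aut_graph_def one_Aut_graph[unfolded Aut_graph_def])
  then have "g \<circ> y = id" "y \<circ> g = id"
    using assms by (simp_all add: mult_Aut_graph)
  then show "y = inv_into UNIV g" by (metis inv_unique_comp)
qed

locale edge_classes =
  fixes E :: "'v::finite set set"
    and \<Gamma> :: "('v \<Rightarrow> 'v) set"
    and cls :: "'c::finite \<Rightarrow> 'v set set"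
  assumes simple: "simple_graph E"
    and sub: "subgroup \<Gamma> (Aut_graph E)"
    and transitive: "vertex_transitive \<Gamma>"
    and enum: "enumerates_edge_classes E \<Gamma> cls"
begin

lemma aut: "g \<in> \<Gamma> \<Longrightarrow> g \<in> graph_aut E"
  using subgroup.subset[OF sub] by (auto simp: Aut_graph_def)

lemma id_mem: "id \<in> \<Gamma>"
  using subgroup.one_closed[OF sub] by (simp add: one_Aut_graph)

lemma comp_mem: "g \<in> \<Gamma> \<Longrightarrow> h \<in> \<Gamma> \<Longrightarrow> g \<circ> h \<in> \<Gamma>"
  using subgroup.m_closed[OF sub, of g h] by (simp add: mult_Aut_graph aut)

lemma inv_mem: "g \<in> \<Gamma> \<Longrightarrow> inv_into UNIV g \<in> \<Gamma>"
  using subgroup.m_inv_closed[OF sub, of g] by (simp add: m_inv_Aut_graph aut)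

lemma edge_image:
  assumes "g \<in> \<Gamma>" "e \<in> E"
  shows "g ` e \<in> E"
proof -
  obtain i j where "e = {i, j}"
    using simple assms(2) by (auto simp: simple_graph_def card_2_iff)
  then show ?thesis using aut[OF assms(1)] assms(2) by (auto simp: graph_aut_def)
qed

lemma equiv_edge_equiv: "equiv E (edge_equiv E \<Gamma>)"
proof (rule equivI)
  show "edge_equiv E \<Gamma> \<subseteq> E \<times> E" by (auto simp: edge_equiv_def)
  show "refl_on E (edge_equiv E \<Gamma>)"
  proof (rule refl_onI)
    fix e assume "e \<in> E"
    moreover have "id ` e = e" by simp
    ultimately show "(e, e) \<in> edge_equiv E \<Gamma>"
      using id_mem unfolding edge_equiv_def by blast
  qed
  show "sym (edge_equiv E \<Gamma>)"
  proof (rule symI)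
    fix e f assume "(e, f) \<in> edge_equiv E \<Gamma>"
    then obtain g where g: "e \<in> E" "f \<in> E" "g \<in> \<Gamma>" "g ` e = f"
      by (auto simp: edge_equiv_def)
    then have "inv_into UNIV g ` f = e"
      using aut[of g] by (auto simp: graph_aut_def bij_is_inj image_inv_f_f)
    then show "(f, e) \<in> edge_equiv E \<Gamma>"
      using g inv_mem[of g] by (auto simp: edge_equiv_def)
  qed
  show "trans (edge_equiv E \<Gamma>)"
  proof (rule transI)
    fix e f h assume "(e, f) \<in> edge_equiv E \<Gamma>" "(f, h) \<in> edge_equiv E \<Gamma>"
    then obtain a b where "e \<in> E" "h \<in> E" "a \<in> \<Gamma>" "b \<in> \<Gamma>" "(b \<circ> a) ` e = h"
      by (auto simp: edge_equiv_def image_comp)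
    then show "(e, h) \<in> edge_equiv E \<Gamma>"
      using comp_mem[of b a] unfolding edge_equiv_def by blast
  qed
qed

lemma cls_quotient: "cls k \<in> E // edge_equiv E \<Gamma>"
  using enum by (auto simp: enumerates_edge_classes_def bij_betw_def)

lemma cls_subset: "e \<in> cls k \<Longrightarrow> e \<in> E"
  using cls_quotient[of k] by (auto elim!: quotientE simp: edge_equiv_def)

text \<open>This makes the \<open>THE\<close> in \<open>transition_matrix\<close> meaningful: the
  classes partition \<open>E\<close>, and injectivity of \<open>cls\<close> turns a unique class
  into a unique index.\<close>

lemma ex1_cls:
  assumes "e \<in> E"
  shows "\<exists>!k. e \<in> cls k"
proof -
  have "edge_equiv E \<Gamma> `` {e} \<in> E // edge_equiv E \<Gamma>" using assms by (rule quotientI)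
  then obtain k where "cls k = edge_equiv E \<Gamma> `` {e}"
    using enum unfolding enumerates_edge_classes_def bij_betw_def by (metis imageE)
  then have "e \<in> cls k" using equiv_class_self[OF equiv_edge_equiv assms] by simp
  moreover have "k' = k''" if "e \<in> cls k'" "e \<in> cls k''" for k' k''
  proof -
    have "cls k' = cls k''"
      using quotient_disj[OF equiv_edge_equiv cls_quotient cls_quotient, of k' k''] that by blast
    then show ?thesis
      using enum by (auto simp: enumerates_edge_classes_def bij_betw_def inj_on_def)
  qed
  ultimately show ?thesis by blast
qed

lemma the_cls: "e \<in> cls k \<Longrightarrow> (THE k. e \<in> cls k) = k"
  using ex1_cls[OF cls_subset] by blast

lemma cls_transitive:
  assumes "e \<in> cls k" "f \<in> cls k"
  obtains g where "g \<in> \<Gamma>" "g ` e = f"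
  using quotient_eq_iff[OF equiv_edge_equiv cls_quotient cls_quotient assms] that
  by (auto simp: edge_equiv_def)

lemma image_cls:
  assumes "g \<in> \<Gamma>" "e \<in> cls k"
  shows "g ` e \<in> cls k"
proof -
  have "(e, g ` e) \<in> edge_equiv E \<Gamma>"
    using assms cls_subset edge_image by (auto simp: edge_equiv_def)
  then show ?thesis
    using assms(2) in_quotient_imp_closed[OF equiv_edge_equiv cls_quotient] by blast
qed

lemma edge_neq: "{i, j} \<in> E \<Longrightarrow> i \<noteq> j"
  using simple by (auto simp: simple_graph_def)

lemma class_degree_eq: "class_degree u (cls k) = class_degree v (cls k)"
  by (rule class_degree_vertex_independent[OF simple sub transitive cls_quotient])

lemma class_degree_eq_card: "class_degree i (cls k) = card {j. {i, j} \<in> cls k}"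
proof -
  have "bij_betw (\<lambda>j. {i, j}) {j. {i, j} \<in> cls k} {e \<in> cls k. i \<in> e}"
  proof (rule bij_betw_imageI)
    show "inj_on (\<lambda>j. {i, j}) {j. {i, j} \<in> cls k}"
      by (auto simp: inj_on_def doubleton_eq_iff)
    have "\<exists>j. e = {i, j}" if "e \<in> cls k" "i \<in> e" for e
    proof -
      have "card e = 2" using simple cls_subset[OF that(1)] by (simp add: simple_graph_def)
      then obtain a b where "e = {a, b}" by (auto simp: card_2_iff)
      then show ?thesis using that(2) by auto
    qed
    then show "(\<lambda>j. {i, j}) ` {j. {i, j} \<in> cls k} = {e \<in> cls k. i \<in> e}" by force
  qed
  from bij_betw_same_card[OF this] show ?thesis by (simp add: class_degree_def)
qed

text \<open>A class is non-empty, so some vertex lies on one of its edges, and the degree does not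
  depend on the vertex. Positivity later allows cancelling the factors \<open>m a\<close> and
  \<open>m b\<close>.\<close>

lemma class_degree_pos: "class_degree v (cls k) > 0"
proof -
  obtain e where e: "e \<in> cls k"
    using in_quotient_imp_non_empty[OF equiv_edge_equiv cls_quotient] by blast
  then have "card e = 2" using simple cls_subset by (auto simp: simple_graph_def)
  then obtain i where "i \<in> e" by fastforce
  then have "class_degree i (cls k) > 0"
    using e by (auto simp: class_degree_def card_gt_0_iff)
  then show ?thesis using class_degree_eq by metis
qed

section \<open>Transition matrices as linear, invariant functions of the weights\<close>

lemma transition_matrix_nth:
  "transition_matrix E cls x $ i $ j = (\<Sum>k\<in>UNIV. if {i, j} \<in> cls k then x $ k else 0)"
proof (cases "{i, j} \<in> E")
  case True
  then obtain k where k: "{i, j} \<in> cls k" using ex1_cls by blast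
  \<comment> \<open>Exactly one summand survives, namely the one that \<open>THE\<close> selects.
    This form of the entry makes linearity in \<open>x\<close> visible.\<close>
  then have "{i, j} \<in> cls k' \<longleftrightarrow> k = k'" for k' using the_cls by metis
  then show ?thesis
    using edge_neq[OF True] True by (simp add: transition_matrix_def the_cls[OF k])
next
  case False
  then have "{i, j} \<notin> cls k" for k using cls_subset by blast
  then show ?thesis using False by (simp add: transition_matrix_def)
qed

lemma transition_matrix_symmetric: "transpose (transition_matrix E cls x) = transition_matrix E cls x"
  by (simp add: vec_eq_iff transpose_def transition_matrix_nth insert_commute)

text \<open>The vectors are arbitrary, so \<open>y\<close> may be a tangent direction with negative
  entries: moving along a line of weights is a linear perturbation of the matrix.\<close>

lemma transition_matrix_add_scaleR:
  "transition_matrix E cls (x + t *\<^sub>R y)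
    = transition_matrix E cls x + t *\<^sub>R transition_matrix E cls y"
proof -
  have "transition_matrix E cls (x + t *\<^sub>R y) $ i $ j
      = transition_matrix E cls x $ i $ j + t * transition_matrix E cls y $ i $ j" for i j
    unfolding transition_matrix_nth sum_distrib_left sum.distrib[symmetric]
    by (intro sum.cong) auto
  then show ?thesis by (simp add: vec_eq_iff)
qed

lemma transition_matrix_invariant:
  assumes "g \<in> \<Gamma>"
  shows "transition_matrix E cls x $ g i $ g j = transition_matrix E cls x $ i $ j"
proof -
  have bij: "bij g" using aut[OF assms] by (simp add: graph_aut_def)
  have "{g i, g j} \<in> cls k \<longleftrightarrow> {i, j} \<in> cls k" for k
  proof
    assume "{g i, g j} \<in> cls k"
    from image_cls[OF inv_mem[OF assms] this] show "{i, j} \<in> cls k"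
      using bij by (simp add: bij_is_inj)
  next
    assume "{i, j} \<in> cls k"
    from image_cls[OF assms this] show "{g i, g j} \<in> cls k" by simp
  qed
  then show ?thesis by (simp add: transition_matrix_nth)
qed

text \<open>Each row contributes every class weight as often as the vertex has neighbours in that
  class. By transitivity all rows give the same value, whence the factor
  \<open>CARD('v)\<close>.\<close>

lemma sum_transition_matrix:
  assumes "\<And>i j k. {i, j} \<in> cls k \<Longrightarrow> h i j = c k"
  shows "(\<Sum>i\<in>UNIV. \<Sum>j\<in>UNIV. transition_matrix E cls x $ i $ j * h i j)
    = real CARD('v) * (\<Sum>k\<in>UNIV. real (class_degree v (cls k)) * c k * x $ k)"
proof -
  have "(\<Sum>j\<in>UNIV. transition_matrix E cls x $ i $ j * h i j)
      = (\<Sum>k\<in>UNIV. real (class_degree v (cls k)) * c k * x $ k)" for i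
  proof -
    have "(\<Sum>j\<in>UNIV. transition_matrix E cls x $ i $ j * h i j)
        = (\<Sum>j\<in>UNIV. \<Sum>k\<in>UNIV. if {i, j} \<in> cls k then c k * x $ k else 0)"
      by (auto simp: transition_matrix_nth sum_distrib_right assms intro!: sum.cong)
    also have "\<dots> = (\<Sum>k\<in>UNIV. \<Sum>j\<in>UNIV. if {i, j} \<in> cls k then c k * x $ k else 0)"
      by (rule sum.swap)
    also have "\<dots> = (\<Sum>k\<in>UNIV. real (class_degree i (cls k)) * c k * x $ k)"
      by (simp add: class_degree_eq_card sum.If_cases mult.assoc)
    finally show ?thesis by (simp only: class_degree_eq[of i _ v])
  qed
  then show ?thesis by simp
qed

end

section \<open>The kernel of a spectral representation\<close>

lemma subspace_eigenspace: "subspace (eigenspace P l)"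
  by (auto simp: subspace_def eigenspace_def matrix_vector_right_distrib scaleR_add_right
      matrix_vector_mult_scaleR)

text \<open>Relabelling the vertices by \<open>g\<close> commutes with \<open>P\<close>, hence
  preserves its eigenspaces.\<close>

lemma eigenspace_comp:
  assumes "bij g" "\<And>i j. P $ g i $ g j = P $ i $ j" "f \<in> eigenspace P l"
  shows "(\<chi> i. f $ g i) \<in> eigenspace P l"
proof -
  have "(\<Sum>j\<in>UNIV. P $ i $ j * f $ g j) = l * f $ g i" for i
  proof -
    have "(\<Sum>j\<in>UNIV. P $ i $ j * f $ g j) = (\<Sum>j\<in>UNIV. P $ g i $ g j * f $ g j)"
      using assms(2) by simp
    also have "\<dots> = (\<Sum>j\<in>UNIV. P $ g i $ j * f $ j)"
      by (rule sum.reindex_bij_betw[OF assms(1)])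
    also have "\<dots> = (P *v f) $ g i" by (simp add: matrix_vector_mult_def)
    also have "\<dots> = l * f $ g i" using assms(3) by (simp add: eigenspace_def)
    finally show ?thesis .
  qed
  then show ?thesis by (simp add: eigenspace_def vec_eq_iff matrix_vector_mult_def)
qed

lemma spectral_kernel_mem:
  assumes "spectral_representation P l \<Phi>"
  shows "(\<chi> i. \<Phi> i \<bullet> \<Phi> j) \<in> eigenspace P l"
proof -
  obtain \<phi> where \<phi>: "orthonormal_basis_of \<phi> (eigenspace P l)" "\<Phi> = (\<lambda>i. \<chi> a. \<phi> a $ i)"
    using assms by (auto simp: spectral_representation_def)
  have "(\<chi> i. \<Phi> i \<bullet> \<Phi> j) = (\<Sum>a\<in>UNIV. \<phi> a $ j *\<^sub>R \<phi> a)"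
    by (simp add: vec_eq_iff \<phi>(2) inner_vec_def mult.commute)
  also have "\<dots> \<in> span (range \<phi>)"
    by (intro span_sum span_scale span_base) auto
  finally show ?thesis using \<phi>(1) by (simp add: orthonormal_basis_of_def)
qed

text \<open>The column \<open>j\<close> of the kernel is the sum of
  \<open>\<phi> a $ j *\<^sub>R \<phi> a\<close>, so pairing with it evaluates each basis vector at
  \<open>j\<close>. Linearity extends this to the whole eigenspace.\<close>

lemma spectral_kernel_reproducing:
  assumes "spectral_representation P l \<Phi>" "f \<in> eigenspace P l"
  shows "(\<chi> i. \<Phi> i \<bullet> \<Phi> j) \<bullet> f = f $ j"
proof -
  obtain \<phi> where \<phi>: "orthonormal_basis_of \<phi> (eigenspace P l)" "\<Phi> = (\<lambda>i. \<chi> a. \<phi> a $ i)"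
    using assms(1) by (auto simp: spectral_representation_def)
  have K: "(\<chi> i. \<Phi> i \<bullet> \<Phi> j) = (\<Sum>a\<in>UNIV. \<phi> a $ j *\<^sub>R \<phi> a)"
    by (simp add: vec_eq_iff \<phi>(2) inner_vec_def mult.commute)
  have "f \<in> span (range \<phi>)" using assms(2) \<phi>(1) by (simp add: orthonormal_basis_of_def)
  then show ?thesis
  proof (induction rule: span_induct)
    case base
    then show ?case by (auto simp: subspace_def inner_add_right)
  next
    case (step x)
    then obtain b where "x = \<phi> b" by auto
    moreover have "\<phi> a $ j * (\<phi> a \<bullet> \<phi> b) = (if a = b then \<phi> a $ j else 0)" for a
      using \<phi>(1) by (simp add: orthonormal_basis_of_def)
    ultimately show ?case by (simp add: K inner_sum_left)
  qed
qed

text \<open>The reproducing property is applied twice, to columns relabelled by \<open>g\<close> and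
  by its inverse \<open>h\<close>; both relabellings stay in the eigenspace. The choice of basis
  never enters.\<close>

lemma spectral_kernel_invariant:
  assumes \<Phi>: "spectral_representation P l \<Phi>"
    and g: "bij g" and inv: "\<And>i j. P $ g i $ g j = P $ i $ j"
  shows "\<Phi> (g i) \<bullet> \<Phi> (g j) = \<Phi> i \<bullet> \<Phi> j"
proof -
  define K where "K = (\<lambda>j. \<chi> i. \<Phi> i \<bullet> \<Phi> j)"
  define h where "h = inv_into UNIV g"
  have h: "bij h" and gh: "g (h i) = i" and hg: "h (g i) = i" for i
    using g by (simp_all add: h_def bij_imp_bij_inv bij_is_surj surj_f_inv_f bij_is_inj)
  have inv_h: "P $ h i $ h j = P $ i $ j" for i j
    using inv[of "h i" "h j"] by (simp add: gh)
  have repr: "K i \<bullet> f = f $ i" if "f \<in> eigenspace P l" for f i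
    unfolding K_def by (rule spectral_kernel_reproducing[OF \<Phi> that])
  have mem: "K i \<in> eigenspace P l" for i
    unfolding K_def by (rule spectral_kernel_mem[OF \<Phi>])
  have "\<Phi> (g i) \<bullet> \<Phi> (g j) = (\<chi> i. K (g j) $ g i) $ i" by (simp add: K_def)
  also have "\<dots> = K i \<bullet> (\<chi> i. K (g j) $ g i)"
    by (rule repr[symmetric, OF eigenspace_comp[OF g inv mem]])
  \<comment> \<open>Writing \<open>K i $ m\<close> as \<open>K i $ h (g m)\<close> makes the summand
    a function of \<open>g m\<close>, ready for reindexing along \<open>g\<close>.\<close>
  also have "\<dots> = (\<Sum>m\<in>UNIV. (\<lambda>m. K i $ h m * K (g j) $ m) (g m))"
    by (simp add: inner_vec_def hg)
  also have "\<dots> = (\<Sum>m\<in>UNIV. K i $ h m * K (g j) $ m)"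
    by (rule sum.reindex_bij_betw[OF g])
  also have "\<dots> = K (g j) \<bullet> (\<chi> m. K i $ h m)"
    by (simp add: inner_vec_def mult.commute)
  also have "\<dots> = K i $ j"
    using repr[OF eigenspace_comp[OF h inv_h mem]] by (simp add: hg)
  finally show ?thesis by (simp add: K_def inner_commute)
qed

section \<open>Differentiating an eigenvalue of constant multiplicity\<close>

lemma orthonormal_basis_exists:
  fixes S :: "(real ^ 'v::finite) set"
  assumes "subspace S" "dim S = CARD('k::finite)"
  obtains \<phi> :: "'k::finite \<Rightarrow> real ^ 'v" where "orthonormal_basis_of \<phi> S"
proof -
  obtain B where B: "pairwise orthogonal B" "\<And>x. x \<in> B \<Longrightarrow> norm x = 1"
      "independent B" "card B = dim S" "span B = S"
    using orthonormal_basis_subspace[OF assms(1)] by metis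
  have "finite B" using B(3) by (rule independent_imp_finite)
  then obtain \<phi> :: "'k \<Rightarrow> real ^ 'v" where \<phi>: "bij_betw \<phi> UNIV B"
    using finite_same_card_bij[of "UNIV :: 'k set" B] B(4) assms(2) by auto
  have "\<phi> a \<bullet> \<phi> b = (if a = b then 1 else 0)" for a b
  proof (cases "a = b")
    case True
    moreover have "\<phi> b \<in> B" using \<phi> by (auto simp: bij_betw_def)
    ultimately show ?thesis using B(2) by (simp add: norm_eq_1)
  next
    case False
    then have "\<phi> a \<noteq> \<phi> b" "\<phi> a \<in> B" "\<phi> b \<in> B"
      using \<phi> by (auto simp: bij_betw_def inj_on_def)
    then show ?thesis using B(1) False by (auto simp: pairwise_def orthogonal_def)
  qed
  moreover have "span (range \<phi>) = S" using \<phi> B(5) by (simp add: bij_betw_def)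
  ultimately show ?thesis using that by (auto simp: orthonormal_basis_of_def)
qed

text \<open>Meant for limits of orthonormal bases: orthonormality and membership in a subspace
  survive the limit, and counting dimensions then recovers the span.\<close>

lemma orthonormal_span_eq:
  fixes \<phi> :: "'k::finite \<Rightarrow> real ^ 'v::finite"
  assumes ortho: "\<And>a b. \<phi> a \<bullet> \<phi> b = (if a = b then 1 else 0)"
    and "range \<phi> \<subseteq> S" "subspace S" "dim S = CARD('k)"
  shows "span (range \<phi>) = S"
proof -
  have "inj \<phi>"
    by (rule injI) (metis ortho zero_neq_one)
  then have "card (range \<phi>) = dim S" using assms(4) by (simp add: card_image)
  moreover have "independent (range \<phi>)"
  proof (rule pairwise_orthogonal_independent)
    show "pairwise orthogonal (range \<phi>)"
      by (auto simp: pairwise_def orthogonal_def ortho)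
    show "0 \<notin> range \<phi>" by (metis imageE inner_zero_left ortho zero_neq_one)
  qed
  ultimately have "S \<subseteq> span (range \<phi>)"
    using assms(2) by (intro card_ge_dim_independent) auto
  then show ?thesis using assms(2,3) by (simp add: span_minimal subset_antisym)
qed

text \<open>No differentiable choice of eigenvectors is made. Orthonormal eigenbases at parameters
  tending to 0 have a convergent subsequence by compactness; constant multiplicity makes the limit a
  basis of the eigenspace at 0. Pairing the perturbed eigenvalue equations with \<open>u\<close>
  turns the difference quotients of \<open>l\<close> into \<open>Q\<close>.\<close>

lemma eigenvalue_derivative_compression:
  fixes P Q :: "real ^ 'v ^ 'v::finite"
  assumes sym: "transpose P = P"
    and l: "(l has_real_derivative d) (at 0)"
    and ev: "\<forall>\<^sub>F t in nhds 0. dim (eigenspace (P + t *\<^sub>R Q) (l t)) = CARD('k::finite)"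
    and u: "u \<in> eigenspace P (l 0)" and w: "w \<in> eigenspace P (l 0)"
  shows "(Q *v w) \<bullet> u = d * (w \<bullet> u)"
proof -
  \<comment> \<open>The filter \<open>nhds 0\<close> includes the point 0 itself, so the
    multiplicity is also known there.\<close>
  have dim0: "dim (eigenspace P (l 0)) = CARD('k)"
    using eventually_nhds_x_imp_x[OF ev] by simp
  have "\<forall>\<^sub>F t in at 0. dim (eigenspace (P + t *\<^sub>R Q) (l t)) = CARD('k)"
    using ev by (simp add: eventually_nhds_conv_at)
  then obtain r where r: "r > 0"
    and dim: "\<And>t. t \<noteq> 0 \<Longrightarrow> dist t 0 < r \<Longrightarrow> dim (eigenspace (P + t *\<^sub>R Q) (l t)) = CARD('k)"
    by (auto simp: eventually_at)
  \<comment> \<open>The shift by 2 keeps \<open>t n\<close> strictly below \<open>r\<close> already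
    at \<open>n = 0\<close>.\<close>
  define t where "t n = r / real (n + 2)" for n
  have t0: "t n \<noteq> 0" and tr: "dist (t n) 0 < r" for n
    using r by (auto simp: t_def field_simps add_pos_nonneg)
  have tlim: "t \<longlonglongrightarrow> 0"
    unfolding t_def by (rule lim_const_over_n[THEN LIMSEQ_ignore_initial_segment])
  have "\<exists>\<phi> :: 'k \<Rightarrow> _. orthonormal_basis_of \<phi> (eigenspace (P + t n *\<^sub>R Q) (l (t n)))" for n
    using orthonormal_basis_exists[OF subspace_eigenspace dim[OF t0 tr]] by metis
  then obtain \<phi> :: "nat \<Rightarrow> 'k \<Rightarrow> _"
    where \<phi>: "\<And>n. orthonormal_basis_of (\<phi> n) (eigenspace (P + t n *\<^sub>R Q) (l (t n)))"
    by metis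
  have ortho: "\<phi> n a \<bullet> \<phi> n b = (if a = b then 1 else 0)" for n a b
    using \<phi> by (simp add: orthonormal_basis_of_def)
  \<comment> \<open>Each basis is bundled into a single vector, so that one subsequence serves all
    its members.\<close>
  have "norm (\<chi> a. \<phi> n a) \<le> real CARD('k)" for n
  proof -
    have "norm (\<chi> a. \<phi> n a) \<le> (\<Sum>a\<in>UNIV. norm (\<phi> n a))"
      by (subst norm_vec_def) (simp add: L2_set_le_sum)
    also have "\<dots> = real CARD('k)" using ortho by (simp add: norm_eq_sqrt_inner)
    finally show ?thesis .
  qed
  then have "bounded (range (\<lambda>n. \<chi> a. \<phi> n a))" by (auto simp: bounded_iff)
  then obtain \<psi> s where s: "strict_mono s" and conv: "((\<lambda>n. \<chi> a. \<phi> n a) \<circ> s) \<longlonglongrightarrow> \<psi>"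
    using bounded_imp_convergent_subsequence by blast
  have lim: "(\<lambda>n. \<phi> (s n) a) \<longlonglongrightarrow> \<psi> $ a" for a
    using tendsto_vec_nth[OF conv, of a] by (simp add: o_def)
  have tslim: "(\<lambda>n. t (s n)) \<longlonglongrightarrow> 0"
    using LIMSEQ_subseq_LIMSEQ[OF tlim s] by (simp add: o_def)
  have "isCont l 0" using l by (rule DERIV_isCont)
  then have llim: "(\<lambda>n. l (t (s n))) \<longlonglongrightarrow> l 0"
    using tslim by (rule isCont_tendsto_compose)
  have mult_lim: "(\<lambda>n. M *v \<phi> (s n) a) \<longlonglongrightarrow> M *v (\<psi> $ a)" for M :: "real ^ 'v ^ 'v" and a
    by (rule bounded_linear.tendsto[OF matrix_vector_mul_bounded_linear lim])
  have eigen: "P *v \<phi> n a + t n *\<^sub>R (Q *v \<phi> n a) = l (t n) *\<^sub>R \<phi> n a" for n a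
  proof -
    have "\<phi> n a \<in> eigenspace (P + t n *\<^sub>R Q) (l (t n))"
      using \<phi>[of n] unfolding orthonormal_basis_of_def by (metis rangeI span_base)
    then show ?thesis
      by (simp add: eigenspace_def matrix_vector_mult_add_rdistrib scaleR_matrix_vector_assoc)
  qed
  have ortho_lim: "\<psi> $ a \<bullet> \<psi> $ b = (if a = b then 1 else 0)" for a b
    using LIMSEQ_unique[OF tendsto_inner[OF lim[of a] lim[of b]]] by (simp add: ortho)
  have mem: "\<psi> $ a \<in> eigenspace P (l 0)" for a
  proof -
    have "(\<lambda>n. P *v \<phi> (s n) a + t (s n) *\<^sub>R (Q *v \<phi> (s n) a)) \<longlonglongrightarrow> P *v \<psi> $ a + 0 *\<^sub>R (Q *v \<psi> $ a)"
      by (intro tendsto_intros mult_lim tslim)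
    moreover have "(\<lambda>n. P *v \<phi> (s n) a + t (s n) *\<^sub>R (Q *v \<phi> (s n) a)) \<longlonglongrightarrow> l 0 *\<^sub>R \<psi> $ a"
      unfolding eigen by (intro tendsto_intros llim lim)
    ultimately show ?thesis using LIMSEQ_unique by (fastforce simp: eigenspace_def)
  qed
  have basis: "(Q *v \<psi> $ a) \<bullet> u = d * (\<psi> $ a \<bullet> u)" for a
  proof -
    \<comment> \<open>Symmetry of \<open>P\<close> moves it onto the eigenvector \<open>u\<close>,
      where it acts as \<open>l 0\<close>. What remains is \<open>l (t n) - l 0\<close> against
      \<open>t n\<close> times the \<open>Q\<close> term.\<close>
    have quotient: "(l (t n) - l 0) / t n * (\<phi> n a \<bullet> u) = (Q *v \<phi> n a) \<bullet> u" for n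
    proof -
      have "(P *v \<phi> n a) \<bullet> u = \<phi> n a \<bullet> (P *v u)"
        by (metis dot_lmul_matrix sym transpose_matrix_vector)
      also have "\<dots> = l 0 * (\<phi> n a \<bullet> u)" using u by (simp add: eigenspace_def)
      finally have "l 0 * (\<phi> n a \<bullet> u) + t n * ((Q *v \<phi> n a) \<bullet> u) = l (t n) * (\<phi> n a \<bullet> u)"
        using arg_cong[OF eigen[of n a], of "\<lambda>x. x \<bullet> u"] by (simp add: inner_add_left)
      then show ?thesis using t0[of n] by (simp add: field_simps)
    qed
    have "filterlim (\<lambda>n. t (s n)) (at 0) sequentially"
      using tslim t0 by (simp add: filterlim_at)
    moreover have "((\<lambda>t. (l t - l 0) / t) \<longlongrightarrow> d) (at 0)"
      using l by (simp add: has_field_derivative_iff)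
    ultimately have "(\<lambda>n. (l (t (s n)) - l 0) / t (s n)) \<longlonglongrightarrow> d"
      by (rule filterlim_compose[rotated])
    then have "(\<lambda>n. (l (t (s n)) - l 0) / t (s n) * (\<phi> (s n) a \<bullet> u)) \<longlonglongrightarrow> d * (\<psi> $ a \<bullet> u)"
      by (intro tendsto_intros lim)
    moreover have "(\<lambda>n. (l (t (s n)) - l 0) / t (s n) * (\<phi> (s n) a \<bullet> u)) \<longlonglongrightarrow> (Q *v \<psi> $ a) \<bullet> u"
      unfolding quotient by (intro tendsto_intros mult_lim)
    ultimately show ?thesis using LIMSEQ_unique by blast
  qed
  have "span (range (($) \<psi>)) = eigenspace P (l 0)"
    by (rule orthonormal_span_eq[OF ortho_lim _ subspace_eigenspace dim0]) (use mem in auto)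
  then have "w \<in> span (range (($) \<psi>))" using w by simp
  then show ?thesis
  proof (induction rule: span_induct)
    case base
    then show ?case
      by (auto simp: subspace_def matrix_vector_right_distrib inner_add_left distrib_left
          matrix_vector_mult_scaleR)
  next
    case (step x)
    then show ?case using basis by auto
  qed
qed

text \<open>The compression identity with both vectors equal to \<open>\<phi> a\<close> gives
  \<open>d\<close> for every \<open>a\<close>. Summing over \<open>a\<close> yields the trace of
  \<open>Q\<close> against the kernel.\<close>

lemma eigenvalue_derivative_trace:
  fixes P Q :: "real ^ 'v ^ 'v::finite" and \<Phi> :: "'v \<Rightarrow> real ^ 'k::finite"
  assumes sym: "transpose P = P"
    and l: "(l has_real_derivative d) (at 0)"
    and ev: "\<forall>\<^sub>F t in nhds 0. dim (eigenspace (P + t *\<^sub>R Q) (l t)) = CARD('k)"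
    and \<Phi>: "spectral_representation P (l 0) \<Phi>"
  shows "real CARD('k) * d = (\<Sum>i\<in>UNIV. \<Sum>j\<in>UNIV. Q $ i $ j * (\<Phi> i \<bullet> \<Phi> j))"
proof -
  obtain \<phi> where \<phi>: "orthonormal_basis_of \<phi> (eigenspace P (l 0))" "\<Phi> = (\<lambda>i. \<chi> a. \<phi> a $ i)"
    using \<Phi> by (auto simp: spectral_representation_def)
  have "\<phi> a \<in> eigenspace P (l 0)" for a
    using \<phi>(1) unfolding orthonormal_basis_of_def by (metis rangeI span_base)
  then have "(Q *v \<phi> a) \<bullet> \<phi> a = d" for a
    using eigenvalue_derivative_compression[OF sym l ev] \<phi>(1)
    by (simp add: orthonormal_basis_of_def)
  then have "real CARD('k) * d = (\<Sum>a\<in>UNIV. (Q *v \<phi> a) \<bullet> \<phi> a)" by simp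
  also have "\<dots> = (\<Sum>a\<in>UNIV. \<Sum>i\<in>UNIV. \<Sum>j\<in>UNIV. Q $ i $ j * (\<phi> a $ i * \<phi> a $ j))"
    by (simp add: inner_vec_def matrix_vector_mult_def sum_distrib_left sum_distrib_right
        mult_ac)
  also have "\<dots> = (\<Sum>i\<in>UNIV. \<Sum>a\<in>UNIV. \<Sum>j\<in>UNIV. Q $ i $ j * (\<phi> a $ i * \<phi> a $ j))"
    by (rule sum.swap)
  also have "\<dots> = (\<Sum>i\<in>UNIV. \<Sum>j\<in>UNIV. \<Sum>a\<in>UNIV. Q $ i $ j * (\<phi> a $ i * \<phi> a $ j))"
    by (intro sum.cong sum.swap refl)
  also have "\<dots> = (\<Sum>i\<in>UNIV. \<Sum>j\<in>UNIV. Q $ i $ j * (\<Phi> i \<bullet> \<Phi> j))"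
    by (simp add: \<phi>(2) inner_vec_def sum_distrib_left)
  finally show ?thesis .
qed

section \<open>Functions on open subsets of the hyperplane\<close>

text \<open>The local smooth extension \<open>F\<close> is differentiable at \<open>x\<close> in the
  ambient space, and \<open>f\<close> agrees with it on \<open>U\<close> near
  \<open>x\<close>.\<close>

lemma smooth_function_on_has_derivative:
  assumes "smooth_function_on f U" "x \<in> U"
  obtains D where "(f has_derivative D) (at x within U)"
proof -
  obtain W F where W: "open W" "x \<in> W" "\<And>n. n_times_cont_diff n F W"
      "\<And>y. y \<in> W \<inter> U \<Longrightarrow> F y = f y"
    using assms unfolding smooth_function_on_def by meson
  have "F differentiable (at x)" using W(3)[of "Suc 0"] W(2) by simp
  then obtain D where "(F has_derivative D) (at x)" by (auto simp: differentiable_def)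
  then have "(F has_derivative D) (at x within U)" by (rule has_derivative_at_withinI)
  moreover have "\<forall>\<^sub>F y in at x within U. F y = f y"
    using W by (auto simp: eventually_at_topological)
  moreover have "F x = f x" using W(2,4) assms(2) by simp
  ultimately have "(f has_derivative D) (at x within U)"
    by (rule has_derivative_transform_eventually) (use assms(2) in auto)
  then show ?thesis by (rule that)
qed

text \<open>The line never leaves the hyperplane because \<xi> is tangent to it; relative openness
  of \<open>U\<close> does the rest for small \<open>t\<close>.\<close>

lemma eventually_line_mem:
  assumes "openin (top_of_set (weight_hyperplane v cls)) U" "x \<in> U"
    and "\<xi> \<in> weight_directions v cls"
  shows "\<forall>\<^sub>F t in nhds 0. x + t *\<^sub>R \<xi> \<in> U"
proof -
  obtain T where T: "open T" "U = weight_hyperplane v cls \<inter> T"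
    using assms(1) by (auto simp: openin_open)
  have "x + t *\<^sub>R \<xi> \<in> weight_hyperplane v cls" for t
  proof -
    have "(\<Sum>j\<in>UNIV. real (class_degree v (cls j)) * (x + t *\<^sub>R \<xi>) $ j)
        = (\<Sum>j\<in>UNIV. real (class_degree v (cls j)) * x $ j)
          + t * (\<Sum>j\<in>UNIV. real (class_degree v (cls j)) * \<xi> $ j)"
      by (simp add: sum_distrib_left sum.distrib algebra_simps)
    then show ?thesis
      using assms(2,3) T(2) by (simp add: weight_hyperplane_def weight_directions_def)
  qed
  moreover have "\<forall>\<^sub>F t in nhds 0. x + t *\<^sub>R \<xi> \<in> T"
  proof -
    have "((\<lambda>t. x + t *\<^sub>R \<xi>) \<longlongrightarrow> x + 0 *\<^sub>R \<xi>) (nhds 0)"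
      by (intro tendsto_intros) (simp add: filterlim_ident)
    then show ?thesis using T assms(2) by (auto simp: tendsto_def)
  qed
  ultimately show ?thesis using T(2) by simp
qed

lemma has_derivative_along_line:
  fixes f :: "'a::real_normed_vector \<Rightarrow> real"
  assumes "(f has_derivative D) (at x within U)" "\<forall>\<^sub>F t in nhds 0. x + t *\<^sub>R \<xi> \<in> U"
  shows "((\<lambda>t. f (x + t *\<^sub>R \<xi>)) has_real_derivative D \<xi>) (at 0)"
proof -
  define S where "S = {t. x + t *\<^sub>R \<xi> \<in> U}"
  have "((\<lambda>t. x + t *\<^sub>R \<xi>) has_derivative (\<lambda>t. t *\<^sub>R \<xi>)) (at 0 within S)"
    by (auto intro!: derivative_eq_intros)
  moreover have "(f has_derivative D) (at (x + 0 *\<^sub>R \<xi>) within (\<lambda>t. x + t *\<^sub>R \<xi>) ` S)"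
    using has_derivative_subset[OF assms(1), of "(\<lambda>t. x + t *\<^sub>R \<xi>) ` S"] by (auto simp: S_def)
  ultimately have "((\<lambda>t. f (x + t *\<^sub>R \<xi>)) has_derivative (\<lambda>t. D (t *\<^sub>R \<xi>))) (at 0 within S)"
    by (rule has_derivative_in_compose)
  \<comment> \<open>The chain rule only yields a derivative within the parameter set
    \<open>S\<close>; an interior point upgrades it to a full derivative.\<close>
  moreover have "0 \<in> interior S"
    using assms(2) by (auto simp: eventually_nhds interior_def S_def)
  moreover have "(\<lambda>t. D (t *\<^sub>R \<xi>)) = (*) (D \<xi>)"
    using linear_scale[OF has_derivative_linear[OF assms(1)]] by (simp add: fun_eq_iff)
  ultimately show ?thesis by (simp only: has_field_derivative_def at_within_interior)
qed

lemma vanishes_on_weight_directions_iff: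
  fixes cls :: "'c::finite \<Rightarrow> 'v set set"
  assumes pos: "\<And>k. class_degree v (cls k) > 0"
  shows "(\<forall>\<xi>\<in>weight_directions v cls. (\<Sum>k\<in>UNIV. real (class_degree v (cls k)) * c k * \<xi> $ k) = 0)
    \<longleftrightarrow> (\<forall>a b. c a = c b)"
proof
  assume L: "\<forall>\<xi>\<in>weight_directions v cls.
    (\<Sum>k\<in>UNIV. real (class_degree v (cls k)) * c k * \<xi> $ k) = 0"
  have "c a = c b" if "a \<noteq> b" for a b
  proof -
    define m where "m k = real (class_degree v (cls k))" for k
    \<comment> \<open>Trading weight between the classes \<open>a\<close> and \<open>b\<close> keeps
      the weighted sum at 0, and the functional takes the value
      \<open>m a * m b * (c a - c b)\<close> on it.\<close>
    define \<xi> where "\<xi> = m b *\<^sub>R axis a 1 - m a *\<^sub>R (axis b 1 :: real ^ 'c)"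
    have sum: "(\<Sum>k\<in>UNIV. h k * \<xi> $ k) = h a * m b - h b * m a" for h
    proof -
      have "(\<Sum>k\<in>UNIV. h k * \<xi> $ k)
          = (\<Sum>k\<in>UNIV. (if k = a then h k * m b else 0) - (if k = b then h k * m a else 0))"
        by (auto simp: \<xi>_def axis_def intro!: sum.cong)
      then show ?thesis by (simp add: sum_subtractf)
    qed
    have "\<xi> \<in> weight_directions v cls"
      using sum[of m] by (simp add: weight_directions_def m_def)
    then have "m a * c a * m b = m b * c b * m a"
      using L sum[of "\<lambda>k. m k * c k"] by (simp add: m_def)
    moreover have "m a > 0" "m b > 0" using pos by (simp_all add: m_def)
    ultimately show ?thesis by simp
  qed
  then show "\<forall>a b. c a = c b" by metis
next
  assume R: "\<forall>a b. c a = c b"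
  show "\<forall>\<xi>\<in>weight_directions v cls. (\<Sum>k\<in>UNIV. real (class_degree v (cls k)) * c k * \<xi> $ k) = 0"
  proof
    fix \<xi> assume \<xi>: "\<xi> \<in> weight_directions v cls"
    have "(\<Sum>k\<in>UNIV. real (class_degree v (cls k)) * c k * \<xi> $ k)
        = c undefined * (\<Sum>k\<in>UNIV. real (class_degree v (cls k)) * \<xi> $ k)"
      unfolding sum_distrib_left by (intro sum.cong refl) (metis R mult.assoc mult.commute)
    then show "(\<Sum>k\<in>UNIV. real (class_degree v (cls k)) * c k * \<xi> $ k) = 0"
      using \<xi> by (simp add: weight_directions_def)
  qed
qed

theorem theorem1p3:
  fixes E :: "'v::finite set set"
    and \<Gamma> :: "('v \<Rightarrow> 'v) set"
    and cls :: "'c::finite \<Rightarrow> 'v set set"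
    and v :: 'v
    and U :: "(real ^ 'c) set"
    and lam :: "real ^ 'c \<Rightarrow> real"
    and X\<^sub>0 :: "real ^ 'c"
    and \<Phi> :: "'v \<Rightarrow> real ^ 'k::finite"
  assumes "simple_graph E" and "connected_graph E"
    and "subgroup \<Gamma> (Aut_graph E)" and "vertex_transitive \<Gamma>"
    and "enumerates_edge_classes E \<Gamma> cls"
    and "U \<subseteq> weight_simplex v cls"
    and "openin (top_of_set (weight_hyperplane v cls)) U"
    and "lam \<in> U \<rightarrow> {-1..1}" and "smooth_function_on lam U"
    and "CARD('k) \<ge> 2"
    and "\<forall>X\<in>U. eigenvalue_of_multiplicity (transition_matrix E cls X) (lam X) CARD('k)"
    and "X\<^sub>0 \<in> U"
    and "spectral_representation (transition_matrix E cls X\<^sub>0) (lam X\<^sub>0) \<Phi>"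
  shows "(\<exists>r>0. \<forall>i. \<Phi> i \<in> sphere 0 r) \<and>
    (critical_point v cls U lam X\<^sub>0 \<longleftrightarrow> equilateral E \<Phi>)"
proof -
  interpret edge_classes E \<Gamma> cls
    using assms(1,3,4,5) by (rule edge_classes.intro)
  note \<Phi> = assms(13)
  have kernel: "\<Phi> (g i) \<bullet> \<Phi> (g j) = \<Phi> i \<bullet> \<Phi> j" if "g \<in> \<Gamma>" for g i j
    using aut[OF that] spectral_kernel_invariant[OF \<Phi> _ transition_matrix_invariant[OF that]]
    by (simp add: graph_aut_def)
  have norm_eq: "norm (\<Phi> i) = norm (\<Phi> v)" for i
  proof -
    obtain g where "g \<in> \<Gamma>" "g v = i" using transitive by (auto simp: vertex_transitive_def)
    then show ?thesis using kernel[of g v v] by (simp add: norm_eq_sqrt_inner)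
  qed
  \<comment> \<open>If the common norm were 0, all basis functions would vanish, against their unit
    length.\<close>
  have "norm (\<Phi> v) > 0"
  proof (rule ccontr)
    assume "\<not> norm (\<Phi> v) > 0"
    then have zero: "\<Phi> i = 0" for i using norm_eq[of i] by simp
    obtain \<phi> :: "'k \<Rightarrow> real ^ 'v"
      where \<phi>: "\<And>a b. \<phi> a \<bullet> \<phi> b = (if a = b then 1 else 0)" "\<Phi> = (\<lambda>i. \<chi> a. \<phi> a $ i)"
      using \<Phi> by (auto simp: spectral_representation_def orthonormal_basis_of_def)
    then have "\<phi> a = 0" for a using zero by (simp add: vec_eq_iff)
    then show False using \<phi>(1)[of undefined undefined] by simp
  qed
  then have sphere: "\<exists>r>0. \<forall>i. \<Phi> i \<in> sphere 0 r"
    using norm_eq by (intro exI[of _ "norm (\<Phi> v)"]) simp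

  \<comment> \<open>Edges are unordered, so an automorphism may match \<open>a\<close>,
    \<open>b\<close> with \<open>i\<close>, \<open>j\<close> in either order; symmetry of the inner
    product covers both.\<close>
  have "\<exists>c. \<forall>i j. {i, j} \<in> cls k \<longrightarrow> \<Phi> i \<bullet> \<Phi> j = c" for k
  proof (cases "\<exists>a b. {a, b} \<in> cls k")
    case True
    then obtain a b where ab: "{a, b} \<in> cls k" by blast
    have "\<Phi> i \<bullet> \<Phi> j = \<Phi> a \<bullet> \<Phi> b" if ij: "{i, j} \<in> cls k" for i j
    proof -
      obtain g where g: "g \<in> \<Gamma>" "g ` {a, b} = {i, j}" using cls_transitive[OF ab ij] .
      then show ?thesis
        using kernel[OF g(1), of a b] by (auto simp: doubleton_eq_iff inner_commute)
    qed
    then show ?thesis by blast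
  qed blast
  then obtain c where c: "\<And>i j k. {i, j} \<in> cls k \<Longrightarrow> \<Phi> i \<bullet> \<Phi> j = c k" by metis

  have derivative: "real CARD('k) * D \<xi>
      = real CARD('v) * (\<Sum>k\<in>UNIV. real (class_degree v (cls k)) * c k * \<xi> $ k)"
    if D: "(lam has_derivative D) (at X\<^sub>0 within U)" and \<xi>: "\<xi> \<in> weight_directions v cls" for D \<xi>
  proof -
    note ev = eventually_line_mem[OF assms(7,12) \<xi>]
    have "\<forall>\<^sub>F t in nhds 0. dim (eigenspace (transition_matrix E cls X\<^sub>0
        + t *\<^sub>R transition_matrix E cls \<xi>) (lam (X\<^sub>0 + t *\<^sub>R \<xi>))) = CARD('k)"
      using ev assms(11)
      by (auto elim!: eventually_mono simp: eigenvalue_of_multiplicity_def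
          transition_matrix_add_scaleR[symmetric])
    from eigenvalue_derivative_trace[OF transition_matrix_symmetric
        has_derivative_along_line[OF D ev] this, of \<Phi>] \<Phi>
    have "real CARD('k) * D \<xi>
        = (\<Sum>i\<in>UNIV. \<Sum>j\<in>UNIV. transition_matrix E cls \<xi> $ i $ j * (\<Phi> i \<bullet> \<Phi> j))" by simp
    also have "\<dots> = real CARD('v) * (\<Sum>k\<in>UNIV. real (class_degree v (cls k)) * c k * \<xi> $ k)"
      by (rule sum_transition_matrix) (rule c)
    finally show ?thesis .
  qed
  \<comment> \<open>This holds for every derivative \<open>D\<close> within \<open>U\<close>, so
    once one exists, the existential in \<open>critical_point\<close> reduces to a condition on
    \<open>c\<close> alone.\<close>
  have D_zero_iff: "D \<xi> = 0 \<longleftrightarrow> (\<Sum>k\<in>UNIV. real (class_degree v (cls k)) * c k * \<xi> $ k) = 0"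
    if "(lam has_derivative D) (at X\<^sub>0 within U)" "\<xi> \<in> weight_directions v cls" for D \<xi>
  proof -
    have "real CARD('k) * D \<xi> = 0 \<longleftrightarrow>
        real CARD('v) * (\<Sum>k\<in>UNIV. real (class_degree v (cls k)) * c k * \<xi> $ k) = 0"
      by (simp only: derivative[OF that])
    then show ?thesis by simp
  qed
  obtain D where "(lam has_derivative D) (at X\<^sub>0 within U)"
    using smooth_function_on_has_derivative[OF assms(9,12)] .
  then have "critical_point v cls U lam X\<^sub>0 \<longleftrightarrow>
      (\<forall>\<xi>\<in>weight_directions v cls. (\<Sum>k\<in>UNIV. real (class_degree v (cls k)) * c k * \<xi> $ k) = 0)"
    unfolding critical_point_def using D_zero_iff by blast
  also have "\<dots> \<longleftrightarrow> (\<forall>a b. c a = c b)"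
    by (rule vanishes_on_weight_directions_iff[OF class_degree_pos])
  also have "\<dots> \<longleftrightarrow> equilateral E \<Phi>"
  proof -
    \<comment> \<open>Since all images have the same norm, the length of an edge depends only on its
      inner product, hence on its class.\<close>
    have edge: "(norm (\<Phi> i - \<Phi> j))\<^sup>2 = 2 * (norm (\<Phi> v))\<^sup>2 - 2 * c k" if "{i, j} \<in> cls k" for i j k
      using c[OF that] norm_eq[of i] norm_eq[of j]
      by (simp add: power2_norm_eq_inner[symmetric] dot_norm_neg)
    have norm_iff: "norm (\<Phi> i - \<Phi> j) = norm (\<Phi> i' - \<Phi> j') \<longleftrightarrow> c k = c k'"
      if "{i, j} \<in> cls k" "{i', j'} \<in> cls k'" for i j i' j' k k'
    proof -
      have "norm (\<Phi> i - \<Phi> j) = norm (\<Phi> i' - \<Phi> j')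
          \<longleftrightarrow> (norm (\<Phi> i - \<Phi> j))\<^sup>2 = (norm (\<Phi> i' - \<Phi> j'))\<^sup>2"
        by (rule power2_eq_iff_nonneg[symmetric]) simp_all
      then show ?thesis by (simp only: edge[OF that(1)] edge[OF that(2)]) simp
    qed
    \<comment> \<open>Every class has an edge, so equal edge lengths constrain each
      \<open>c k\<close>.\<close>
    have edge_ex: "\<exists>i j. {i, j} \<in> cls k" for k
    proof -
      have "card {j. {v, j} \<in> cls k} > 0"
        using class_degree_pos[of v k] by (simp add: class_degree_eq_card)
      then show ?thesis by (auto simp: card_gt_0_iff)
    qed
    show ?thesis
    proof
      assume "\<forall>a b. c a = c b"
      then show "equilateral E \<Phi>"
        unfolding equilateral_def using norm_iff ex1_cls by metis
    next
      assume "equilateral E \<Phi>"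
      then show "\<forall>a b. c a = c b"
        unfolding equilateral_def using norm_iff edge_ex cls_subset by metis
    qed
  qed
  finally show ?thesis using sphere by blast
qed

end
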